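(* Let $p$ be an integer greater than $1$ and let $G$ be a connected $\{\text{butterfly},\text{hammer},(K_1\cup K_2)+K_p\}$-free graph. If $\omega(G)\geq 2p$, then $G$ is a multisplit graph.
   Context: All graphs are simple, finite and undirected. $\omega(G)$ is the clique number of $G$. For a family $\mathcal{F}$ of graphs, $G$ is $\mathcal{F}$-free if it has no induced subgraph isomorphic to a member of $\mathcal{F}$. The butterfly is the graph on five vertices consisting of two triangles sharing exactly one vertex (with no other edges). The hammer is the graph on five vertices $a,b,c,d,e$ with edges $ab,bc,ac,cd,de$. $K_n$ is the complete graph on $n$ vertices, $K_1\cup K_2$ is the disjoint union of $K_1$ and $K_2$, and for vertex-disjoint graphs $G_1,G_2$ the join $G_1+G_2$ is obtained from their disjoint union by adding all edges between $V(G_1)$ and $V(G_2)$. A graph $G$ is a multisplit graph if $V(G)$ can be partitioned into two subsets $V_1$ and $V_2$ such that $V_1$ induces a complete multipartite graph and $V_2$ is an independent set in $G$. *)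

theory Defs
  imports Graph_Theory.Graph_Theory "HOL-Library.Disjoint_Sets"
begin

text \<open>
  Finite simple undirected graphs are the finite loop-free symmetric digraphs without parallel
  arcs of \<^locale>\<open>pair_graph\<close>: the edge \<open>uv\<close> is the pair of arcs \<open>(u, v)\<close> and \<open>(v, u)\<close>.
\<close>

definition graph_of_edges :: "'a set \<Rightarrow> ('a \<times> 'a) set \<Rightarrow> 'a pair_pre_digraph" where
  "graph_of_edges V E = \<lparr> pverts = V, parcs = E \<union> E\<inverse> \<rparr>"

definition butterfly :: "nat pair_pre_digraph" where
  "butterfly = graph_of_edges {0, 1, 2, 3, 4} {(0, 1), (0, 2), (1, 2), (0, 3), (0, 4), (3, 4)}"

text \<open>The vertices \<open>a, b, c, d, e\<close> are numbered \<open>0, 1, 2, 3, 4\<close>.\<close>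

definition hammer :: "nat pair_pre_digraph" where
  "hammer = graph_of_edges {0, 1, 2, 3, 4} {(0, 1), (1, 2), (0, 2), (2, 3), (3, 4)}"

text \<open>The complete graph with vertex set \<open>V\<close>; it is a copy of \<open>K\<^sub>n\<close> when \<open>V\<close> has \<open>n\<close> elements.\<close>

definition complete_graph_on :: "'a set \<Rightarrow> 'a pair_pre_digraph" where
  "complete_graph_on V = \<lparr> pverts = V, parcs = {(u, v). u \<in> V \<and> v \<in> V \<and> u \<noteq> v} \<rparr>"

lemma complete_graph_on_complete_digraph:
  assumes "finite V"
  shows "complete_digraph (card V) (with_proj (complete_graph_on V))"
  using assms by (auto simp: complete_digraph_pair_def complete_graph_on_def)

text \<open>
  Union and join are meant for vertex-disjoint arguments; taking the copies disjoint is left to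
  the place of use.
\<close>

definition graph_union :: "'a pair_pre_digraph \<Rightarrow> 'a pair_pre_digraph \<Rightarrow> 'a pair_pre_digraph" where
  "graph_union G H = \<lparr> pverts = pverts G \<union> pverts H, parcs = parcs G \<union> parcs H \<rparr>"

definition graph_join :: "'a pair_pre_digraph \<Rightarrow> 'a pair_pre_digraph \<Rightarrow> 'a pair_pre_digraph" where
  "graph_join G H = \<lparr> pverts = pverts G \<union> pverts H,
     parcs = parcs G \<union> parcs H \<union> pverts G \<times> pverts H \<union> pverts H \<times> pverts G \<rparr>"

text \<open>\<open>(K\<^sub>1 \<union> K\<^sub>2) + K\<^sub>p\<close> on the pairwise disjoint vertex sets \<open>{0}\<close>, \<open>{1, 2}\<close>, \<open>{3, \<dots>, p + 2}\<close>.\<close>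

definition K1_K2_join_Kp :: "nat \<Rightarrow> nat pair_pre_digraph" where
  "K1_K2_join_Kp p =
     graph_join (graph_union (complete_graph_on {0}) (complete_graph_on {1, 2}))
       (complete_graph_on {3..<p + 3})"

definition free_of :: "'b pair_pre_digraph set \<Rightarrow> 'a pair_pre_digraph \<Rightarrow> bool" where
  "free_of \<F> G \<longleftrightarrow>
     \<not> (\<exists>H :: 'a pair_pre_digraph. \<exists>F \<in> \<F>.
          induced_subgraph (with_proj H) (with_proj G) \<and> digraph_iso (with_proj H) (with_proj F))"

definition clique :: "'a pair_pre_digraph \<Rightarrow> 'a set \<Rightarrow> bool" where
  "clique G S \<longleftrightarrow> S \<subseteq> pverts G \<and> (\<forall>u \<in> S. \<forall>v \<in> S. u \<noteq> v \<longrightarrow> (u, v) \<in> parcs G)"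

definition clique_number :: "'a pair_pre_digraph \<Rightarrow> nat" where
  "clique_number G = Max {card S | S. clique G S}"

definition independent :: "'a pair_pre_digraph \<Rightarrow> 'a set \<Rightarrow> bool" where
  "independent G S \<longleftrightarrow> S \<subseteq> pverts G \<and> (\<forall>u \<in> S. \<forall>v \<in> S. (u, v) \<notin> parcs G)"

definition complete_multipartite :: "('a, 'b) pre_digraph \<Rightarrow> bool" where
  "complete_multipartite H \<longleftrightarrow>
     (\<exists>P. partition_on (verts H) P \<and>
        arcs_ends H = {(u, v). \<exists>A \<in> P. \<exists>B \<in> P. A \<noteq> B \<and> u \<in> A \<and> v \<in> B})"

text \<open>Either part may be empty.\<close>

definition multisplit :: "'a pair_pre_digraph \<Rightarrow> bool" where
  "multisplit G \<longleftrightarrow>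
     (\<exists>V\<^sub>1 V\<^sub>2. V\<^sub>1 \<union> V\<^sub>2 = pverts G \<and> V\<^sub>1 \<inter> V\<^sub>2 = {} \<and>
        complete_multipartite (with_proj G \<restriction> V\<^sub>1) \<and> independent G V\<^sub>2)"

end

theory Submission
  imports Defs
begin

text \<open>
  Fix a maximum clique \<open>K\<close>. A vertex with two non-neighbours in \<open>K\<close> has fewer than \<open>p\<close> neighbours
  there, because \<open>(K\<^sub>1 \<union> K\<^sub>2) + K\<^sub>p\<close> is forbidden; every other vertex has exactly one non-neighbour
  in \<open>K\<close> (members of \<open>K\<close> being non-neighbours of themselves). Grouping the latter by this
  non-neighbour gives the complete multipartite part; exchanging a vertex of \<open>K\<close> for another one in its
  group yields a maximum clique again, so non-adjacent vertices in different groups would have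
  \<open>card K - 2 \<ge> p\<close> common neighbours in such a clique. The former vertices are
  independent: the ends of an edge \<open>uv\<close> between them have two common non-neighbours in \<open>K\<close>, so
  if \<open>u\<close> were adjacent to a vertex of \<open>K\<close>, a butterfly or a hammer would arise. Exchanging again,
  neither \<open>u\<close> nor \<open>v\<close> has a neighbour in the multipartite part, against connectedness.
\<close>

section \<open>Induced copies of forbidden graphs\<close>

text \<open>The image of \<open>F\<close> under \<open>g\<close>, with its arcs carried along, is an
  induced subgraph of \<open>G\<close>, and the inverse of \<open>g\<close> is an isomorphism back
  to \<open>F\<close>. Later uses thus only need an injection that preserves and reflects
  arcs.\<close>

lemma free_ofD:
  assumes "free_of \<F> G" "F \<in> \<F>" "pair_wf_digraph G" "pair_wf_digraph F"
    and inj: "inj_on g (pverts F)" and sub: "g ` pverts F \<subseteq> pverts G"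
    and arcs: "\<And>u v. u \<in> pverts F \<Longrightarrow> v \<in> pverts F \<Longrightarrow>
      (u, v) \<in> parcs F \<longleftrightarrow> (g u, g v) \<in> parcs G"
  shows False
proof -
  interpret G: pair_wf_digraph G by fact
  interpret F: pair_wf_digraph F by fact
  define h where "h = the_inv_into (pverts F) g"
  define H where "H = \<lparr> pverts = g ` pverts F, parcs = map_prod g g ` parcs F \<rparr>"
  have h: "h (g u) = u" if "u \<in> pverts F" for u
    using the_inv_into_f_f[OF inj that] by (simp add: h_def)
  have parcs_F: "u \<in> pverts F" "v \<in> pverts F" if "(u, v) \<in> parcs F" for u v
    using that F.in_arcsD1 F.in_arcsD2 by auto
  interpret H: pair_wf_digraph H
    by unfold_locales (auto simp: H_def dest: parcs_F)
  have parcs_H: "(x, y) \<in> parcs H \<longleftrightarrow> (x, y) \<in> parcs G"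
    if xy: "x \<in> pverts H" "y \<in> pverts H" for x y
  proof -
    obtain u v where uv: "u \<in> pverts F" "v \<in> pverts F" "x = g u" "y = g v"
      using xy by (auto simp: H_def)
    have "(g u, g v) \<in> map_prod g g ` parcs F \<longleftrightarrow> (u, v) \<in> parcs F"
    proof
      assume "(g u, g v) \<in> map_prod g g ` parcs F"
      then obtain u' v' where "(u', v') \<in> parcs F" "g u = g u'" "g v = g v'"
        by auto
      then show "(u, v) \<in> parcs F"
        using uv parcs_F by (metis inj inj_onD)
    qed force
    then show ?thesis
      using uv arcs by (simp add: H_def)
  qed
  have arcs_H: "parcs H = {e \<in> parcs G. fst e \<in> pverts H \<and> snd e \<in> pverts H}"
    by (rule set_eqI)
      (metis (lifting) mem_Collect_eq parcs_H H.arc_fst_in_verts H.arc_snd_in_verts prod.collapse)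
  then have "subgraph (with_proj H) (with_proj G)"
    using sub G.wf_digraph_axioms H.wf_digraph_axioms
    by (intro subgraphI) (auto simp: H_def compatible_def)
  then have "induced_subgraph (with_proj H) (with_proj G)"
    unfolding induced_subgraph_def with_proj_simps using arcs_H by blast
  moreover have "digraph_iso (with_proj H) (with_proj F)"
    unfolding digraph_iso_def
  proof (intro exI conjI)
    let ?f = "\<lparr> iso_verts = h, iso_arcs = map_prod h h, iso_head = snd, iso_tail = fst \<rparr>"
    have inj_h: "inj_on h (pverts H)"
      by (auto simp: H_def inj_on_def h)
    moreover have "inj_on (map_prod h h) (parcs H)"
      using map_prod_inj_on[OF inj_h inj_h]
      by (rule inj_on_subset) (auto dest: H.in_arcsD1 H.in_arcsD2)
    ultimately show "pre_digraph.digraph_isomorphism (with_proj H) ?f"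
      by (auto simp: pre_digraph.digraph_isomorphism_def H.wf_digraph_axioms)
    have "h ` pverts H = pverts F"
      by (force simp: H_def h image_image)
    moreover have "map_prod h h ` parcs H = parcs F"
    proof -
      have "map_prod h h (map_prod g g e) = e" if "e \<in> parcs F" for e
        using that by (cases e) (auto simp: h parcs_F)
      then show ?thesis
        by (simp add: H_def image_image)
    qed
    ultimately show "with_proj F = app_iso ?f (with_proj H)"
      by (simp add: app_iso_def with_proj_def)
  qed
  ultimately show False
    using assms(1,2) unfolding free_of_def by blast
qed

lemma pair_wf_digraph_graph_of_edges:
  "E \<subseteq> V \<times> V \<Longrightarrow> pair_wf_digraph (graph_of_edges V E)"
  by unfold_locales (auto simp: graph_of_edges_def)

lemma pair_wf_digraph_K1_K2_join_Kp: "pair_wf_digraph (K1_K2_join_Kp p)"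
  by unfold_locales
    (auto simp: K1_K2_join_Kp_def graph_join_def graph_union_def complete_graph_on_def)

lemma cliqueD: "clique G K \<Longrightarrow> u \<in> K \<Longrightarrow> v \<in> K \<Longrightarrow> u \<noteq> v \<Longrightarrow> (u, v) \<in> parcs G"
  by (simp add: clique_def)

section \<open>Maximum cliques\<close>

context pair_graph
begin

lemma arc_sym: "(u, v) \<in> parcs G \<longleftrightarrow> (v, u) \<in> parcs G"
  using pair_sym_arcs by (auto simp: symmetric_def dest: symD)

lemma no_loop: "(u, u) \<notin> parcs G"
  using pair_no_loops by fastforce

lemma finite_clique: "clique G K \<Longrightarrow> finite K"
  using pair_finite_verts by (auto simp: clique_def intro: finite_subset)

lemma finite_cliques: "finite {card K | K. clique G K}"
proof -
  have "{card K | K. clique G K} \<subseteq> card ` Pow (pverts G)"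
    by (auto simp: clique_def)
  then show ?thesis
    using pair_finite_verts by (simp add: finite_subset)
qed

lemma card_clique_le: "clique G K \<Longrightarrow> card K \<le> clique_number G"
  unfolding clique_number_def using finite_cliques by (intro Max_ge) auto

lemma obtain_maximum_clique:
  obtains K where "clique G K" "card K = clique_number G"
proof -
  \<comment> \<open>The empty clique makes the set under \<open>Max\<close> nonempty, so the maximum
    is attained.\<close>
  have "clique G {}"
    by (simp add: clique_def)
  then have "clique_number G \<in> {card K | K. clique G K}"
    unfolding clique_number_def using finite_cliques by (intro Max_in) auto
  then show ?thesis
    using that by auto
qed

lemma clique_insertI:
  assumes "clique G K" "v \<in> pverts G" "\<And>k. k \<in> K \<Longrightarrow> (v, k) \<in> parcs G"
  shows "clique G (insert v K)"
  using assms arc_sym by (auto simp: clique_def)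

text \<open>Otherwise adding \<open>v\<close> would enlarge a maximum clique. For \<open>v\<close>
  in \<open>K\<close> the vertex \<open>v\<close> itself qualifies, as there are no loops.\<close>

lemma maximum_clique_nonneighbour:
  assumes K: "clique G K" "card K = clique_number G" and v: "v \<in> pverts G"
  obtains k where "k \<in> K" "(v, k) \<notin> parcs G"
proof (cases "\<forall>k \<in> K. (v, k) \<in> parcs G")
  case True
  then have "v \<notin> K"
    using no_loop by blast
  moreover have "clique G (insert v K)"
    using True K v by (intro clique_insertI) auto
  ultimately have False
    using card_clique_le[of "insert v K"] finite_clique K by auto
  then show ?thesis ..
qed (use that in blast)

text \<open>Since \<open>k\<close> is the only vertex of \<open>K\<close> that \<open>v\<close>
  misses, \<open>v\<close> can take its place. The case \<open>v = k\<close> is included and leaves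
  \<open>K\<close> unchanged.\<close>

lemma maximum_clique_exchange:
  assumes K: "clique G K" "card K = clique_number G"
    and v: "v \<in> pverts G" "{l \<in> K. (v, l) \<notin> parcs G} = {k}"
  shows "clique G (insert v (K - {k}))" "card (insert v (K - {k})) = clique_number G"
proof -
  have k: "k \<in> K" and adj: "\<And>l. l \<in> K - {k} \<Longrightarrow> (v, l) \<in> parcs G"
    using v by blast+
  have "clique G (K - {k})"
    using K by (auto simp: clique_def)
  then show "clique G (insert v (K - {k}))"
    using v adj by (intro clique_insertI) auto
  have "v \<notin> K - {k}"
    using adj no_loop by blast
  moreover have "card (K - {k}) = card K - 1" "0 < card K"
    using k finite_clique[OF K(1)] by (auto simp: card_gt_0_iff)
  ultimately show "card (insert v (K - {k})) = clique_number G"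
    using finite_clique K by simp
qed

section \<open>Configurations excluded by the forbidden graphs\<close>

text \<open>The five vertices induce a butterfly centred at \<open>x\<close> if \<open>x\<close> and
  \<open>v\<close> are adjacent, and otherwise a hammer with tail \<open>x\<close>,
  \<open>u\<close>, \<open>v\<close>.\<close>

lemma no_path_from_triangle:
  assumes free: "free_of \<F> G" "butterfly \<in> \<F>" "hammer \<in> \<F>"
    and arcs: "(x, y) \<in> parcs G" "(x, z) \<in> parcs G" "(y, z) \<in> parcs G"
      "(x, u) \<in> parcs G" "(u, v) \<in> parcs G"
    and no_arcs: "(u, y) \<notin> parcs G" "(u, z) \<notin> parcs G" "(v, y) \<notin> parcs G" "(v, z) \<notin> parcs G"
  shows False
proof -
  have no_arcs': "(y, u) \<notin> parcs G" "(z, u) \<notin> parcs G" "(y, v) \<notin> parcs G" "(z, v) \<notin> parcs G"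
    using no_arcs arc_sym by blast+
  note adj = arcs arcs[THEN arc_sym[THEN iffD1]] no_arcs no_arcs' no_loop
  have dist: "distinct [x, y, z, u, v]"
    using adj by auto
  have verts: "{x, y, z, u, v} \<subseteq> pverts G"
    using arcs in_arcsD1 in_arcsD2 by auto
  show False
  proof (cases "(x, v) \<in> parcs G")
    case True
    moreover from this have "(v, x) \<in> parcs G"
      using arc_sym by blast
    ultimately have arcs_iff: "(m, n) \<in> parcs butterfly \<longleftrightarrow> ([x, y, z, u, v] ! m, [x, y, z, u, v] ! n) \<in> parcs G"
      if "m \<in> {0, 1, 2, 3, 4}" "n \<in> {0, 1, 2, 3, 4}" for m n
      using that adj unfolding butterfly_def graph_of_edges_def
      by (elim insertE emptyE) simp_all
    have pverts: "pverts butterfly = {0, 1, 2, 3, 4}"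
      by (simp add: butterfly_def graph_of_edges_def)
    show False
    proof (rule free_ofD[OF free(1,2) pair_wf_digraph_axioms, where g = "(!) [x, y, z, u, v]"])
      show "pair_wf_digraph butterfly"
        unfolding butterfly_def by (intro pair_wf_digraph_graph_of_edges) simp
      show "inj_on ((!) [x, y, z, u, v]) (pverts butterfly)"
        unfolding pverts using dist by (intro inj_on_nth) auto
      show "(!) [x, y, z, u, v] ` pverts butterfly \<subseteq> pverts G"
        unfolding pverts using verts by simp
    qed (simp add: arcs_iff pverts)
  next
    case False
    moreover from this have "(v, x) \<notin> parcs G"
      using arc_sym by blast
    \<comment> \<open>In \<open>hammer\<close> the triangle vertex that carries the tail has number
      2, so \<open>x\<close> now comes third.\<close>
    ultimately have arcs_iff: "(m, n) \<in> parcs hammer \<longleftrightarrow> ([y, z, x, u, v] ! m, [y, z, x, u, v] ! n) \<in> parcs G"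
      if "m \<in> {0, 1, 2, 3, 4}" "n \<in> {0, 1, 2, 3, 4}" for m n
      using that adj unfolding hammer_def graph_of_edges_def
      by (elim insertE emptyE) simp_all
    have pverts: "pverts hammer = {0, 1, 2, 3, 4}"
      by (simp add: hammer_def graph_of_edges_def)
    show False
    proof (rule free_ofD[OF free(1,3) pair_wf_digraph_axioms, where g = "(!) [y, z, x, u, v]"])
      show "pair_wf_digraph hammer"
        unfolding hammer_def by (intro pair_wf_digraph_graph_of_edges) simp
      show "inj_on ((!) [y, z, x, u, v]) (pverts hammer)"
        unfolding pverts using dist by (intro inj_on_nth) auto
      show "(!) [y, z, x, u, v] ` pverts hammer \<subseteq> pverts G"
        unfolding pverts using verts by simp
    qed (simp add: arcs_iff pverts)
  qed
qed

lemma card_neighbours_less: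
  assumes free: "free_of \<F> G" "K1_K2_join_Kp p \<in> \<F>"
    and K: "clique G K" and a: "a \<in> pverts G"
    and bc: "b \<in> K" "c \<in> K" "b \<noteq> c" "(a, b) \<notin> parcs G" "(a, c) \<notin> parcs G"
  shows "card {k \<in> K. (a, k) \<in> parcs G} < p"
proof (rule ccontr)
  assume "\<not> ?thesis"
  then have "p \<le> card {k \<in> K. (a, k) \<in> parcs G}"
    by simp
  then obtain T where T: "T \<subseteq> {k \<in> K. (a, k) \<in> parcs G}" "card T = p" "finite T"
    by (rule obtain_subset_with_card_n)
  then obtain f where f: "bij_betw f {3..<p + 3} T"
    using finite_same_card_bij[of "{3..<p + 3}" T] by auto
  define g where "g n = (if n = 0 then a else if n = 1 then b else if n = 2 then c else f n)" for n
  have g_simps: "g 0 = a" "g (Suc 0) = b" "g 2 = c" "\<And>n. 3 \<le> n \<Longrightarrow> g n = f n"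
    by (auto simp: g_def)
  have f_T: "f n \<in> T" if "3 \<le> n" "n < p + 3" for n
    using that f by (auto simp: bij_betw_def)
  have f_inj: "f m = f n \<longleftrightarrow> m = n" if "3 \<le> m" "m < p + 3" "3 \<le> n" "n < p + 3" for m n
    using that f by (auto simp: bij_betw_def inj_on_def)
  have T_adj: "t \<in> K" "(a, t) \<in> parcs G" "(t, a) \<in> parcs G" if "t \<in> T" for t
    using that T arc_sym[of a t] by auto
  \<comment> \<open>A member of \<open>K\<close> would be adjacent to whichever of \<open>b\<close>
    and \<open>c\<close> differs from it.\<close>
  have "a \<notin> K"
    using bc cliqueD[OF K] by blast
  have T_neq: "t \<noteq> a" "t \<noteq> b" "t \<noteq> c" if "t \<in> T" for t
    using T_adj[OF that] bc \<open>a \<notin> K\<close> by blast+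
  have K_adj: "(s, t) \<in> parcs G \<longleftrightarrow> s \<noteq> t" if "s \<in> K" "t \<in> K" for s t
    using that cliqueD[OF K] no_loop by blast
  have bc': "a \<noteq> b" "a \<noteq> c" "(b, a) \<notin> parcs G" "(c, a) \<notin> parcs G"
    using bc \<open>a \<notin> K\<close> arc_sym by blast+
  have pverts: "pverts (K1_K2_join_Kp p) = {0, 1, 2} \<union> {3..<p + 3}"
    by (auto simp: K1_K2_join_Kp_def graph_join_def graph_union_def complete_graph_on_def)
  show False
  proof (rule free_ofD[OF free pair_wf_digraph_axioms pair_wf_digraph_K1_K2_join_Kp, of g])
    show "inj_on g (pverts (K1_K2_join_Kp p))"
      unfolding pverts
    proof (rule inj_onI)
      fix m n assume "m \<in> {0, 1, 2} \<union> {3..<p + 3}" "n \<in> {0, 1, 2} \<union> {3..<p + 3}" "g m = g n"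
      then show "m = n"
        by (elim UnE insertE emptyE)
          (simp_all add: g_simps f_inj f_T bc(3) bc(3)[symmetric] bc'(1,2) bc'(1,2)[symmetric]
            T_neq T_neq[symmetric])
    qed
    show "g ` pverts (K1_K2_join_Kp p) \<subseteq> pverts G"
      unfolding pverts using T_adj(1)[OF f_T] bc a K by (auto simp: g_simps clique_def)
    fix m n assume "m \<in> pverts (K1_K2_join_Kp p)" "n \<in> pverts (K1_K2_join_Kp p)"
    then show "(m, n) \<in> parcs (K1_K2_join_Kp p) \<longleftrightarrow> (g m, g n) \<in> parcs G"
      unfolding pverts
      by (elim UnE insertE emptyE)
        (simp_all add: g_simps f_inj f_T T_adj K_adj T_neq T_neq[symmetric] no_loop bc bc(3)[symmetric]
          bc' K1_K2_join_Kp_def graph_join_def graph_union_def complete_graph_on_def)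
  qed
qed

text \<open>A set closed under arcs contains everything reachable from it, and symmetry of the arcs
  turns connectedness into reachability between any two vertices.\<close>

lemma connected_arc_closed:
  assumes "Digraph_Component.connected (with_proj G)" "S \<noteq> {}" "S \<subseteq> pverts G"
    and closed: "\<And>u w. u \<in> S \<Longrightarrow> (u, w) \<in> parcs G \<Longrightarrow> w \<in> S"
  shows "S = pverts G"
proof -
  have strongly: "strongly_connected (with_proj G)"
    using symmetric_connected_imp_strongly_connected[OF pair_sym_arcs assms(1)] .
  have "w \<in> S" if "u \<in> S" "w \<in> pverts G" for u w
  proof -
    have "u \<rightarrow>\<^sup>*\<^bsub>with_proj G\<^esub> w"
      using strongly that assms(3) unfolding strongly_connected_def with_proj_simps by blast
    then show ?thesis
      using \<open>u \<in> S\<close> by (induction rule: reachable_induct) (simp, simp add: closed)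
  qed
  then show ?thesis
    using assms by blast
qed

section \<open>The multisplit partition\<close>

lemma multisplit_if_free:
  assumes p: "p > 1" and conn: "Digraph_Component.connected (with_proj G)"
    and free: "free_of {butterfly, hammer, K1_K2_join_Kp p} G"
    and omega: "clique_number G \<ge> 2 * p"
  shows "multisplit G"
proof -
  obtain K where K: "clique G K" "card K = clique_number G"
    by (rule obtain_maximum_clique)
  note fin = finite_clique[OF K(1)]
  have nbrs: "card {k \<in> L. (a, k) \<in> parcs G} < p"
    if "clique G L" "a \<in> pverts G" "b \<in> L" "c \<in> L" "b \<noteq> c" "(a, b) \<notin> parcs G" "(a, c) \<notin> parcs G"
    for L a b c
    using card_neighbours_less[OF free _ that] by simp
  have no_path: False
    if "(x, y) \<in> parcs G" "(x, z) \<in> parcs G" "(y, z) \<in> parcs G" "(x, u) \<in> parcs G" "(u, v) \<in> parcs G"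
      "(u, y) \<notin> parcs G" "(u, z) \<notin> parcs G" "(v, y) \<notin> parcs G" "(v, z) \<notin> parcs G" for x y z u v
    using no_path_from_triangle[OF free _ _ that] by simp
  define part where "part k = {v \<in> pverts G. {l \<in> K. (v, l) \<notin> parcs G} = {k}}" for k
  define A where "A = (\<Union>k \<in> K. part k)"
  define B where "B = pverts G - A"

  have part_self: "k \<in> part k" if "k \<in> K" for k
    using that K no_loop by (auto simp: part_def clique_def)
  have part_eq: "k = l" if "v \<in> part k" "v \<in> part l" for v k l
    using that by (auto simp: part_def)
  have part_inj: "part k = part l \<longleftrightarrow> k = l" if "k \<in> K" for k l
    using part_self[OF that] part_eq by metis
  have partD: "v \<in> pverts G" "{l \<in> K. (v, l) \<notin> parcs G} = {k}" if "v \<in> part k" for v k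
    using that by (auto simp: part_def)
  have part_adj: "(v, l) \<in> parcs G" if "v \<in> part k" "l \<in> K" "l \<noteq> k" for v k l
    using partD(2)[OF that(1)] that by blast

  have same: "(u, v) \<notin> parcs G" if uv: "u \<in> part k" "v \<in> part k" for u v k
  proof
    assume arc: "(u, v) \<in> parcs G"
    \<comment> \<open>Exchanging \<open>k\<close> for \<open>v\<close> gives a maximum clique, so
      \<open>u\<close> misses some member; yet \<open>u\<close> is adjacent to \<open>v\<close> and
      to all of \<open>K - {k}\<close>.\<close>
    obtain l where l: "l \<in> insert v (K - {k})" "(u, l) \<notin> parcs G"
      using maximum_clique_nonneighbour maximum_clique_exchange[OF K partD[OF uv(2)]] partD(1)[OF uv(1)]
      by metis
    then show False
      using arc part_adj[OF uv(1)] by auto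
  qed

  have diff: "(u, v) \<in> parcs G" if u: "u \<in> part k" and v: "v \<in> part l" and "k \<in> K" "l \<in> K" "k \<noteq> l"
    for u v k l
  proof (rule ccontr)
    assume no_arc: "(u, v) \<notin> parcs G"
    \<comment> \<open>This clique contains two non-neighbours of \<open>v\<close>, namely
      \<open>u\<close> and \<open>l\<close>, so \<open>nbrs\<close> applies to it.\<close>
    let ?L = "insert u (K - {k})"
    note L = maximum_clique_exchange[OF K partD[OF u]]
    have "(v, l) \<notin> parcs G"
      using partD(2)[OF v] by blast
    moreover have "u \<noteq> l"
      using no_arc part_adj[OF v \<open>k \<in> K\<close>] u v that(4,5) part_self part_adj arc_sym part_eq by metis
    ultimately have "card {x \<in> ?L. (v, x) \<in> parcs G} < p"
      using nbrs[OF L(1), of v u l] no_arc arc_sym partD(1)[OF v] that by auto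
    moreover have "K - {k, l} \<subseteq> {x \<in> ?L. (v, x) \<in> parcs G}"
      using part_adj[OF v] by auto
    moreover have "card (K - {k, l}) = card K - 2"
      using that by (simp add: card_Diff_subset)
    ultimately have "card K - 2 < p"
      using card_mono[of "{x \<in> ?L. (v, x) \<in> parcs G}" "K - {k, l}"] fin by simp
    \<comment> \<open>The size of \<open>K\<close> gives \<open>2 * p - 2 < p\<close>, which
      contradicts \<open>p > 1\<close>.\<close>
    then show False
      using K omega p by simp
  qed

  have B_nbrs: "card {k \<in> K. (v, k) \<in> parcs G} < p" if "v \<in> B" for v
  proof -
    have v: "v \<in> pverts G" "v \<notin> A"
      using that by (auto simp: B_def)
    obtain b where b: "b \<in> K" "(v, b) \<notin> parcs G"
      using maximum_clique_nonneighbour[OF K v(1)] .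
    \<comment> \<open>With \<open>b\<close> as its only non-neighbour in \<open>K\<close>,
      \<open>v\<close> would lie in \<open>part b\<close> and hence in \<open>A\<close>.\<close>
    then obtain c where "c \<in> K" "(v, c) \<notin> parcs G" "b \<noteq> c"
      using v by (auto simp: A_def part_def)
    then show ?thesis
      using nbrs[OF K(1) v(1)] b by blast
  qed

  have B_no_nbr: "(u, k) \<notin> parcs G"
    if uv: "u \<in> B" "v \<in> B" "(u, v) \<in> parcs G" and k: "k \<in> K" for u v k
  proof
    assume arc: "(u, k) \<in> parcs G"
    let ?N = "{l \<in> K. (u, l) \<in> parcs G} \<union> {l \<in> K. (v, l) \<in> parcs G}"
    have "card ?N \<le> card {l \<in> K. (u, l) \<in> parcs G} + card {l \<in> K. (v, l) \<in> parcs G}"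
      by (rule card_Un_le)
    \<comment> \<open>Each of \<open>u\<close> and \<open>v\<close> has at most \<open>p - 1\<close>
      neighbours among the at least \<open>2 * p\<close> vertices of \<open>K\<close>.\<close>
    then have "2 \<le> card (K - ?N)"
      using B_nbrs[OF uv(1)] B_nbrs[OF uv(2)] K omega fin card_Diff_subset[of ?N K] by simp
    then obtain y z where "y \<in> K - ?N" "z \<in> K - ?N" "y \<noteq> z"
      by (meson card_2_iff' obtain_subset_with_card_n subsetD)
    then show False
      using no_path[of k y z u v] cliqueD[OF K(1)] arc arc_sym uv k by blast
  qed

  have B_indep: "(u, v) \<notin> parcs G" if "u \<in> B" "v \<in> B" for u v
  proof
    assume uv: "(u, v) \<in> parcs G"
    \<comment> \<open>If nonempty, this set will turn out closed under arcs, hence equal to the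
      whole vertex set, although it avoids \<open>K\<close>.\<close>
    define S where "S = {u \<in> B. \<exists>v \<in> B. (u, v) \<in> parcs G}"
    have "w \<in> S" if "u \<in> S" and uw: "(u, w) \<in> parcs G" for u w
    proof (rule ccontr)
      obtain v where v: "u \<in> B" "v \<in> B" "(u, v) \<in> parcs G"
        using \<open>u \<in> S\<close> by (auto simp: S_def)
      assume "w \<notin> S"
      \<comment> \<open>A neighbour \<open>w\<close> of \<open>u\<close> in \<open>B\<close> would
        belong to \<open>S\<close>, with \<open>u\<close> as its partner.\<close>
      then have "w \<in> A"
        using uw v in_arcsD2 arc_sym by (auto simp: S_def B_def)
      then obtain k where k: "k \<in> K" "w \<in> part k"
        by (auto simp: A_def)
      have "2 \<le> card (K - {k})"
        using K omega p k fin by simp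
      then obtain y z where yz: "y \<in> K - {k}" "z \<in> K - {k}" "y \<noteq> z"
        by (meson card_2_iff' obtain_subset_with_card_n subsetD)
      have "(w, y) \<in> parcs G" "(w, z) \<in> parcs G" "(y, z) \<in> parcs G"
        using yz part_adj[OF k(2)] cliqueD[OF K(1)] by auto
      \<comment> \<open>By \<open>B_no_nbr\<close> neither \<open>u\<close> nor \<open>v\<close> has
        a neighbour in \<open>K\<close>, so the triangle \<open>w\<close>, \<open>y\<close>,
        \<open>z\<close> and the path \<open>w\<close>, \<open>u\<close>, \<open>v\<close> are as in
        \<open>no_path\<close>.\<close>
      then show False
        using no_path[of w y z u v] B_no_nbr[OF v] B_no_nbr[OF v(2,1)] v arc_sym uw yz by blast
    qed
    moreover have "S \<noteq> {}" "S \<subseteq> pverts G"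
      using uv that by (auto simp: S_def B_def)
    ultimately have "S = pverts G"
      using connected_arc_closed[OF conn] by blast
    moreover have "K \<noteq> {}"
      using K omega p by auto
    ultimately show False
      using K part_self by (fastforce simp: S_def B_def A_def clique_def)
  qed

  have "complete_multipartite (with_proj G \<restriction> A)"
    unfolding complete_multipartite_def
  proof (intro exI conjI)
    show "partition_on (verts (with_proj G \<restriction> A)) (part ` K)"
    proof (rule partition_onI)
      show "disjnt P Q" if "P \<in> part ` K" "Q \<in> part ` K" "P \<noteq> Q" for P Q
        using that part_eq unfolding disjnt_def by blast
    qed (use part_self in \<open>auto simp: A_def\<close>)
    have "arcs_ends (with_proj G \<restriction> A) = {(u, v). (u, v) \<in> parcs G \<and> u \<in> A \<and> v \<in> A}"
      by (auto simp: arcs_ends_conv)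
    also have "\<dots> = {(u, v). \<exists>P \<in> part ` K. \<exists>Q \<in> part ` K. P \<noteq> Q \<and> u \<in> P \<and> v \<in> Q}"
      (is "?L = ?R")
    proof (rule set_eqI, clarify)
      fix u v
      \<comment> \<open>By \<open>same\<close>, adjacent vertices of \<open>A\<close> have different
        indices; the converse is \<open>diff\<close>. Then \<open>part_inj\<close> replaces
        different indices by different parts.\<close>
      have "(u, v) \<in> ?L \<longleftrightarrow> (\<exists>k \<in> K. \<exists>l \<in> K. k \<noteq> l \<and> u \<in> part k \<and> v \<in> part l)"
        unfolding A_def mem_Collect_eq prod.case UN_iff using same diff by metis
      also have "\<dots> \<longleftrightarrow> (u, v) \<in> ?R"
        by (auto simp: part_inj)
      finally show "(u, v) \<in> ?L \<longleftrightarrow> (u, v) \<in> ?R" .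
    qed
    finally show "arcs_ends (with_proj G \<restriction> A) =
        {(u, v). \<exists>P \<in> part ` K. \<exists>Q \<in> part ` K. P \<noteq> Q \<and> u \<in> P \<and> v \<in> Q}" .
  qed
  moreover have "independent G B"
    using B_indep by (auto simp: independent_def B_def)
  moreover have "A \<union> B = pverts G" "A \<inter> B = {}"
    using partD(1) by (auto simp: A_def B_def)
  ultimately show ?thesis
    unfolding multisplit_def by blast
qed

end

theorem theorem3p15:
  fixes p :: nat and G :: "'a pair_pre_digraph"
  assumes "p > 1"
    and "pair_graph G"
    and "Digraph_Component.connected (with_proj G)"
    and "free_of {butterfly, hammer, K1_K2_join_Kp p} G"
    and "clique_number G \<ge> 2 * p"
  shows "multisplit G"
  using pair_graph.multisplit_if_free assms by blast

end
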